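(* Let $\mathcal{C}$ be an additive category and $n\geqslant 2$ an integer, and let $F:\mathcal{C}[\epsilon]^n\to\mathcal{C}$ be the forgetful functor and $T:\mathcal{C}\to\mathcal{C}[\epsilon]^n$ the augmenting functor. Then both $(F,T)$ and $(T,F)$ are adjoint pairs.
   Context: The category $\mathcal{C}[\epsilon]^n$ has as objects pairs $(X,\epsilon_X)$ with $X\in\mathcal{C}$, $\epsilon_X\in\operatorname{End}_{\mathcal{C}}(X)$, $\epsilon_X^n=0$; morphisms $(X,\epsilon_X)\to(Y,\epsilon_Y)$ are morphisms $f:X\to Y$ in $\mathcal{C}$ with $f\epsilon_X=\epsilon_Yf$. The forgetful functor is $F(X,\epsilon_X)=X$, $F(f)=f$. The augmenting functor sends $X$ to $T(X)=(X^{\oplus n},\epsilon_{X^{\oplus n}})$, where $\epsilon_{X^{\oplus n}}$ is the $n\times n$ matrix with entries $1_X$ in positions $(i+1,i)$, $1\leqslant i\leqslant n-1$, and $0$ elsewhere, and sends $f$ to the diagonal matrix $\operatorname{diag}(f,\dots,f)$. In an adjoint pair $(G,H)$, $G$ is left adjoint to $H$. *)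

theory Defs
  imports "HOL-Algebra.FiniteProduct"
begin

section \<open>Categories, functors and adjoint pairs\<close>

text \<open>
  A category is given by its set of objects and its family of hom-sets. Hom-sets for different
  pairs of objects may overlap, so all operations are indexed by the objects involved;
  \<open>Comp C X Y Z g f\<close> is the composite of \<open>f : X \<rightarrow> Y\<close> followed by \<open>g : Y \<rightarrow> Z\<close>.
\<close>

record ('o, 'm) cat =
  Ob :: "'o set"
  Hom :: "'o \<Rightarrow> 'o \<Rightarrow> 'm set"
  Id :: "'o \<Rightarrow> 'm"
  Comp :: "'o \<Rightarrow> 'o \<Rightarrow> 'o \<Rightarrow> 'm \<Rightarrow> 'm \<Rightarrow> 'm"

locale category =
  fixes C :: "('o, 'm, 'x) cat_scheme"
  assumes Id_closed: "X \<in> Ob C \<Longrightarrow> Id C X \<in> Hom C X X"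
    and Comp_closed: "\<lbrakk>X \<in> Ob C; Y \<in> Ob C; Z \<in> Ob C; f \<in> Hom C X Y; g \<in> Hom C Y Z\<rbrakk>
      \<Longrightarrow> Comp C X Y Z g f \<in> Hom C X Z"
    and Comp_Id_right: "\<lbrakk>X \<in> Ob C; Y \<in> Ob C; f \<in> Hom C X Y\<rbrakk> \<Longrightarrow> Comp C X X Y f (Id C X) = f"
    and Comp_Id_left: "\<lbrakk>X \<in> Ob C; Y \<in> Ob C; f \<in> Hom C X Y\<rbrakk> \<Longrightarrow> Comp C X Y Y (Id C Y) f = f"
    and Comp_assoc: "\<lbrakk>W \<in> Ob C; X \<in> Ob C; Y \<in> Ob C; Z \<in> Ob C;
        f \<in> Hom C W X; g \<in> Hom C X Y; h \<in> Hom C Y Z\<rbrakk>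
      \<Longrightarrow> Comp C W Y Z h (Comp C W X Y g f) = Comp C W X Z (Comp C X Y Z h g) f"

text \<open>\<open>Map F X Y f\<close> is the image of \<open>f : X \<rightarrow> Y\<close>.\<close>

record ('o, 'm, 'p, 'q) func =
  Obj :: "'o \<Rightarrow> 'p"
  Map :: "'o \<Rightarrow> 'o \<Rightarrow> 'm \<Rightarrow> 'q"

locale cat_functor = A: category A + B: category B
  for A :: "('o, 'm, 'x) cat_scheme" and B :: "('p, 'q, 'y) cat_scheme" +
  fixes F :: "('o, 'm, 'p, 'q) func"
  assumes Obj_closed: "X \<in> Ob A \<Longrightarrow> Obj F X \<in> Ob B"
    and Map_closed: "\<lbrakk>X \<in> Ob A; Y \<in> Ob A; f \<in> Hom A X Y\<rbrakk>
      \<Longrightarrow> Map F X Y f \<in> Hom B (Obj F X) (Obj F Y)"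
    and Map_Id: "X \<in> Ob A \<Longrightarrow> Map F X X (Id A X) = Id B (Obj F X)"
    and Map_Comp: "\<lbrakk>X \<in> Ob A; Y \<in> Ob A; Z \<in> Ob A; f \<in> Hom A X Y; g \<in> Hom A Y Z\<rbrakk>
      \<Longrightarrow> Map F X Z (Comp A X Y Z g f)
          = Comp B (Obj F X) (Obj F Y) (Obj F Z) (Map F Y Z g) (Map F X Y f)"

text \<open>
  \<open>adjoint_pair A B G H\<close>: the functor \<open>G : A \<rightarrow> B\<close> is left adjoint to \<open>H : B \<rightarrow> A\<close>, i.e. there are
  bijections \<open>B(G X, Y) \<cong> A(X, H Y)\<close> natural in \<open>X\<close> and in \<open>Y\<close>.
\<close>

definition adjoint_pair ::
  "('o, 'm, 'x) cat_scheme \<Rightarrow> ('p, 'q, 'y) cat_scheme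
    \<Rightarrow> ('o, 'm, 'p, 'q) func \<Rightarrow> ('p, 'q, 'o, 'm) func \<Rightarrow> bool"
where
  "adjoint_pair A B G H \<longleftrightarrow>
     cat_functor A B G \<and> cat_functor B A H \<and>
     (\<exists>\<phi> :: 'o \<Rightarrow> 'p \<Rightarrow> 'q \<Rightarrow> 'm.
        (\<forall>X\<in>Ob A. \<forall>Y\<in>Ob B. bij_betw (\<phi> X Y) (Hom B (Obj G X) Y) (Hom A X (Obj H Y))) \<and>
        (\<forall>X\<in>Ob A. \<forall>X'\<in>Ob A. \<forall>Y\<in>Ob B. \<forall>a\<in>Hom A X' X. \<forall>k\<in>Hom B (Obj G X) Y.
           \<phi> X' Y (Comp B (Obj G X') (Obj G X) Y k (Map G X' X a))
             = Comp A X' X (Obj H Y) (\<phi> X Y k) a) \<and>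
        (\<forall>X\<in>Ob A. \<forall>Y\<in>Ob B. \<forall>Y'\<in>Ob B. \<forall>b\<in>Hom B Y Y'. \<forall>k\<in>Hom B (Obj G X) Y.
           \<phi> X Y' (Comp B (Obj G X) Y Y' b k)
             = Comp A X (Obj H Y) (Obj H Y') (Map H Y Y' b) (\<phi> X Y k)))"


section \<open>Additive categories\<close>

record ('o, 'm) acat = "('o, 'm) cat" +
  Add :: "'o \<Rightarrow> 'o \<Rightarrow> 'm \<Rightarrow> 'm \<Rightarrow> 'm"
  Zero :: "'o \<Rightarrow> 'o \<Rightarrow> 'm"

text \<open>
  The group operation of \<open>hom_group C X Y\<close> is addition of morphisms, so \<open>finprod\<close> over it is the
  finite \<^emph>\<open>sum\<close> of morphisms; powers in \<open>End_monoid C X\<close> are iterated composites.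
\<close>

definition hom_group :: "('o, 'm, 'x) acat_scheme \<Rightarrow> 'o \<Rightarrow> 'o \<Rightarrow> 'm monoid" where
  "hom_group C X Y = \<lparr>carrier = Hom C X Y, mult = Add C X Y, one = Zero C X Y\<rparr>"

definition End_monoid :: "('o, 'm, 'x) cat_scheme \<Rightarrow> 'o \<Rightarrow> 'm monoid" where
  "End_monoid C X = \<lparr>carrier = Hom C X X, mult = Comp C X X X, one = Id C X\<rparr>"

definition biproduct ::
  "('o, 'm, 'x) acat_scheme \<Rightarrow> nat \<Rightarrow> (nat \<Rightarrow> 'o) \<Rightarrow> 'o \<Rightarrow> (nat \<Rightarrow> 'm) \<Rightarrow> (nat \<Rightarrow> 'm) \<Rightarrow> bool"
where
  "biproduct C n A S \<iota> \<pi> \<longleftrightarrow>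
     S \<in> Ob C \<and>
     (\<forall>i\<in>{1..n}. A i \<in> Ob C \<and> \<iota> i \<in> Hom C (A i) S \<and> \<pi> i \<in> Hom C S (A i)) \<and>
     (\<forall>i\<in>{1..n}. \<forall>j\<in>{1..n}.
        Comp C (A j) S (A i) (\<pi> i) (\<iota> j) = (if i = j then Id C (A i) else Zero C (A j) (A i))) \<and>
     finprod (hom_group C S S) (\<lambda>i. Comp C S (A i) S (\<iota> i) (\<pi> i)) {1..n} = Id C S"

text \<open>All finite biproducts are required; the case \<open>n = 0\<close> is the existence of a zero object.\<close>

locale additive_category = category C for C :: "('o, 'm, 'x) acat_scheme" +
  assumes hom_comm_group: "\<lbrakk>X \<in> Ob C; Y \<in> Ob C\<rbrakk> \<Longrightarrow> comm_group (hom_group C X Y)"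
    and Comp_Add_right: "\<lbrakk>X \<in> Ob C; Y \<in> Ob C; Z \<in> Ob C;
        f \<in> Hom C X Y; f' \<in> Hom C X Y; g \<in> Hom C Y Z\<rbrakk>
      \<Longrightarrow> Comp C X Y Z g (Add C X Y f f') = Add C X Z (Comp C X Y Z g f) (Comp C X Y Z g f')"
    and Comp_Add_left: "\<lbrakk>X \<in> Ob C; Y \<in> Ob C; Z \<in> Ob C;
        f \<in> Hom C X Y; g \<in> Hom C Y Z; g' \<in> Hom C Y Z\<rbrakk>
      \<Longrightarrow> Comp C X Y Z (Add C Y Z g g') f = Add C X Z (Comp C X Y Z g f) (Comp C X Y Z g' f)"
    and finite_biproducts: "(\<And>i. i \<in> {1..n} \<Longrightarrow> A i \<in> Ob C) \<Longrightarrow> \<exists>S \<iota> \<pi>. biproduct C n A S \<iota> \<pi>"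

text \<open>A choice of biproducts \<open>P X = X\<^sup>\<oplus>\<^sup>n\<close>, with their injections and projections.\<close>

definition biproduct_powers ::
  "('o, 'm, 'x) acat_scheme \<Rightarrow> nat \<Rightarrow> ('o \<Rightarrow> 'o) \<Rightarrow> ('o \<Rightarrow> nat \<Rightarrow> 'm) \<Rightarrow> ('o \<Rightarrow> nat \<Rightarrow> 'm) \<Rightarrow> bool"
where
  "biproduct_powers C n P \<iota> \<pi> \<longleftrightarrow> (\<forall>X\<in>Ob C. biproduct C n (\<lambda>_. X) (P X) (\<iota> X) (\<pi> X))"

lemma (in additive_category) biproduct_powers_exist: "\<exists>P \<iota> \<pi>. biproduct_powers C n P \<iota> \<pi>"
proof -
  have "\<forall>X\<in>Ob C. \<exists>S i p. biproduct C n (\<lambda>_. X) S i p"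
    using finite_biproducts[of n "\<lambda>_. X" for X] by blast
  then show ?thesis
    unfolding biproduct_powers_def by metis
qed

text \<open>
  The morphism \<open>X\<^sup>\<oplus>\<^sup>n \<rightarrow> Y\<^sup>\<oplus>\<^sup>n\<close> with matrix \<open>(a i j)\<close> is the sum of all
  \<open>\<iota>\<^sub>i \<circ> a i j \<circ> \<pi>\<^sub>j\<close>: matrices act on columns, the entry in position \<open>(i, j)\<close> going from the
  \<open>j\<close>-th summand of the source to the \<open>i\<close>-th summand of the target.
\<close>

definition matrix_mor ::
  "('o, 'm, 'x) acat_scheme \<Rightarrow> nat \<Rightarrow> ('o \<Rightarrow> 'o) \<Rightarrow> ('o \<Rightarrow> nat \<Rightarrow> 'm) \<Rightarrow> ('o \<Rightarrow> nat \<Rightarrow> 'm)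
    \<Rightarrow> 'o \<Rightarrow> 'o \<Rightarrow> (nat \<Rightarrow> nat \<Rightarrow> 'm) \<Rightarrow> 'm"
where
  "matrix_mor C n P \<iota> \<pi> X Y a =
     finprod (hom_group C (P X) (P Y))
       (\<lambda>(i, j). Comp C (P X) Y (P Y) (\<iota> Y i) (Comp C (P X) X Y (a i j) (\<pi> X j)))
       ({1..n} \<times> {1..n})"


section \<open>The category of nilpotent endomorphisms\<close>

definition eps_cat :: "('o, 'm, 'x) acat_scheme \<Rightarrow> nat \<Rightarrow> ('o \<times> 'm, 'm) cat" where
  "eps_cat C n =
     \<lparr>Ob = {(X, e). X \<in> Ob C \<and> e \<in> Hom C X X \<and> e [^]\<^bsub>End_monoid C X\<^esub> n = Zero C X X},
      Hom = (\<lambda>(X, e) (Y, d). {f \<in> Hom C X Y. Comp C X X Y f e = Comp C X Y Y d f}),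
      Id = (\<lambda>(X, _). Id C X),
      Comp = (\<lambda>(X, _) (Y, _) (Z, _). Comp C X Y Z)\<rparr>"

definition forgetful :: "('o \<times> 'm, 'm, 'o, 'm) func" where
  "forgetful = \<lparr>Obj = fst, Map = (\<lambda>_ _ f. f)\<rparr>"

definition augmenting ::
  "('o, 'm, 'x) acat_scheme \<Rightarrow> nat \<Rightarrow> ('o \<Rightarrow> 'o) \<Rightarrow> ('o \<Rightarrow> nat \<Rightarrow> 'm) \<Rightarrow> ('o \<Rightarrow> nat \<Rightarrow> 'm)
    \<Rightarrow> ('o, 'm, 'o \<times> 'm, 'm) func"
where
  "augmenting C n P \<iota> \<pi> =
     \<lparr>Obj = (\<lambda>X. (P X, matrix_mor C n P \<iota> \<pi> X X
                         (\<lambda>i j. if i = j + 1 then Id C X else Zero C X X))),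
      Map = (\<lambda>X Y f. matrix_mor C n P \<iota> \<pi> X Y (\<lambda>i j. if i = j then f else Zero C X Y))\<rparr>"

end

theory Submission
  imports Defs
begin

text \<open>
  Let \<open>S\<close> be the nilpotent endomorphism of \<open>T X = X\<^sup>\<oplus>\<^sup>n\<close>. It shifts the summands by one place:
  \<open>S \<iota>\<^sub>j = \<iota>\<^bsub>j+1\<^esub>\<close> and \<open>\<pi>\<^sub>i S = \<pi>\<^bsub>i-1\<^esub>\<close>, where the terms with index \<open>n + 1\<close> and \<open>0\<close> are zero. Thus \<open>T X\<close>
  plays the role of \<open>X \<otimes> \<int>[\<epsilon>]/(\<epsilon>\<^sup>n)\<close>, with \<open>S\<close> as multiplication by \<open>\<epsilon>\<close>.

  A morphism \<open>h : T X \<rightarrow> (Y, d)\<close> satisfies \<open>h S = d h\<close>, so its components obey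
  \<open>h \<iota>\<^bsub>i+1\<^esub> = d (h \<iota>\<^sub>i)\<close>. Hence \<open>h\<close> is determined by \<open>k = h \<iota>\<^sub>1 : X \<rightarrow> Y\<close>. Conversely, for every \<open>k\<close> the
  components \<open>d\<^bsup>i-1\<^esup> k\<close> define such an \<open>h\<close>; the only remaining condition is \<open>0 = h S \<iota>\<^sub>n = d\<^sup>n k\<close>,
  which is the nilpotency of \<open>d\<close>. So \<open>\<iota>\<^sub>1\<close> is the unit of an adjunction \<open>(T, F)\<close>
  (\<open>first_inj_universal\<close>).

  Dually, a morphism \<open>g : (X, e) \<rightarrow> T Y\<close> satisfies \<open>g e = S g\<close>, so \<open>\<pi>\<^bsub>i-1\<^esub> g = (\<pi>\<^sub>i g) e\<close>, and \<open>g\<close> is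
  determined by \<open>k = \<pi>\<^sub>n g\<close>. Conversely the components \<open>k e\<^bsup>n-i\<^esup>\<close> define a morphism because
  \<open>k e\<^sup>n = 0\<close>. So \<open>\<pi>\<^sub>n\<close> is the counit of an adjunction \<open>(F, T)\<close> (\<open>last_proj_universal\<close>).

  Naturality of the bijections follows from that of the universal arrows, since a natural family
  of universal arrows gives an adjunction (\<open>adjoint_pair_of_universal_unit\<close> and
  \<open>adjoint_pair_of_universal_counit\<close>), and \<open>\<iota>\<^sub>1\<close> and \<open>\<pi>\<^sub>n\<close> are natural because \<open>T f\<close> is diagonal.
\<close>

section \<open>Adjunctions from universal arrows\<close>

text \<open>
  The adjunction bijection is \<open>k \<mapsto> H k \<circ> \<eta> X\<close>. Universality of the arrows \<open>\<eta> X\<close> says exactly that it is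
  bijective; it is natural in \<open>Y\<close> by functoriality of \<open>H\<close>, and in \<open>X\<close> by naturality of \<open>\<eta>\<close>.
\<close>

lemma adjoint_pair_of_universal_unit:
  assumes G: "cat_functor A B G" and H: "cat_functor B A H"
    and unit: "\<And>X. X \<in> Ob A \<Longrightarrow> \<eta> X \<in> Hom A X (Obj H (Obj G X))"
    and natural: "\<And>X X' a. \<lbrakk>X \<in> Ob A; X' \<in> Ob A; a \<in> Hom A X' X\<rbrakk> \<Longrightarrow>
      Comp A X' X (Obj H (Obj G X)) (\<eta> X) a
        = Comp A X' (Obj H (Obj G X')) (Obj H (Obj G X))
            (Map H (Obj G X') (Obj G X) (Map G X' X a)) (\<eta> X')"
    and universal: "\<And>X Y f. \<lbrakk>X \<in> Ob A; Y \<in> Ob B; f \<in> Hom A X (Obj H Y)\<rbrakk> \<Longrightarrow>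
      \<exists>!k. k \<in> Hom B (Obj G X) Y
        \<and> Comp A X (Obj H (Obj G X)) (Obj H Y) (Map H (Obj G X) Y k) (\<eta> X) = f"
  shows "adjoint_pair A B G H"
proof -
  interpret G: cat_functor A B G by (rule G)
  interpret H: cat_functor B A H by (rule H)
  define \<phi> where "\<phi> X Y k =
    Comp A X (Obj H (Obj G X)) (Obj H Y) (Map H (Obj G X) Y k) (\<eta> X)" for X Y k
  have mem: "\<phi> X Y k \<in> Hom A X (Obj H Y)"
    if "X \<in> Ob A" "Y \<in> Ob B" "k \<in> Hom B (Obj G X) Y" for X Y k
    unfolding \<phi>_def using that by (intro G.A.Comp_closed unit H.Map_closed G.Obj_closed H.Obj_closed)
  have bij: "bij_betw (\<phi> X Y) (Hom B (Obj G X) Y) (Hom A X (Obj H Y))"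
    if "X \<in> Ob A" "Y \<in> Ob B" for X Y
  proof (rule bij_betwI')
    fix k k' assume k: "k \<in> Hom B (Obj G X) Y" and k': "k' \<in> Hom B (Obj G X) Y"
    show "\<phi> X Y k = \<phi> X Y k' \<longleftrightarrow> k = k'"
      using universal[OF that mem[OF that k'], folded \<phi>_def] k k' by auto
  next
    fix f assume "f \<in> Hom A X (Obj H Y)"
    from ex1_implies_ex[OF universal[OF that this, folded \<phi>_def]]
    show "\<exists>k\<in>Hom B (Obj G X) Y. f = \<phi> X Y k" by blast
  qed (rule mem[OF that])
  have left: "\<phi> X' Y (Comp B (Obj G X') (Obj G X) Y k (Map G X' X a))
      = Comp A X' X (Obj H Y) (\<phi> X Y k) a"
    if X: "X \<in> Ob A" and X': "X' \<in> Ob A" and Y: "Y \<in> Ob B"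
      and a: "a \<in> Hom A X' X" and k: "k \<in> Hom B (Obj G X) Y" for X X' Y a k
    unfolding \<phi>_def using that
    by (simp add: H.Map_Comp[of "Obj G X'" "Obj G X" Y] natural G.Map_closed G.Obj_closed
        H.Obj_closed H.Map_closed unit
        G.A.Comp_assoc[of X' "Obj H (Obj G X')" "Obj H (Obj G X)" "Obj H Y", symmetric]
        G.A.Comp_assoc[of X' X "Obj H (Obj G X)" "Obj H Y", symmetric])
  have right: "\<phi> X Y' (Comp B (Obj G X) Y Y' b k)
      = Comp A X (Obj H Y) (Obj H Y') (Map H Y Y' b) (\<phi> X Y k)"
    if "X \<in> Ob A" "Y \<in> Ob B" "Y' \<in> Ob B" "b \<in> Hom B Y Y'" "k \<in> Hom B (Obj G X) Y" for X Y Y' b k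
    unfolding \<phi>_def using that
    by (simp add: H.Map_Comp G.Obj_closed H.Obj_closed H.Map_closed unit
        G.A.Comp_assoc[of X "Obj H (Obj G X)" "Obj H Y" "Obj H Y'"])
  show ?thesis
    unfolding adjoint_pair_def
    by (intro conjI exI[of _ \<phi>] ballI G H bij left right)
qed

text \<open>
  The dual criterion. A counit describes the bijection in the direction from \<open>A(X, H Y)\<close> to
  \<open>B(G X, Y)\<close>, opposite to the one in \<open>adjoint_pair\<close>. The required map \<open>\<phi>\<close> is its inverse, and
  each naturality law for \<open>\<phi>\<close> is checked by applying \<open>\<psi>\<close> to both sides.
\<close>

lemma adjoint_pair_of_universal_counit:
  assumes G: "cat_functor A B G" and H: "cat_functor B A H"
    and counit: "\<And>Y. Y \<in> Ob B \<Longrightarrow> \<theta> Y \<in> Hom B (Obj G (Obj H Y)) Y"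
    and natural: "\<And>Y Y' b. \<lbrakk>Y \<in> Ob B; Y' \<in> Ob B; b \<in> Hom B Y Y'\<rbrakk> \<Longrightarrow>
      Comp B (Obj G (Obj H Y)) Y Y' b (\<theta> Y)
        = Comp B (Obj G (Obj H Y)) (Obj G (Obj H Y')) Y'
            (\<theta> Y') (Map G (Obj H Y) (Obj H Y') (Map H Y Y' b))"
    and universal: "\<And>X Y k. \<lbrakk>X \<in> Ob A; Y \<in> Ob B; k \<in> Hom B (Obj G X) Y\<rbrakk> \<Longrightarrow>
      \<exists>!f. f \<in> Hom A X (Obj H Y)
        \<and> Comp B (Obj G X) (Obj G (Obj H Y)) Y (\<theta> Y) (Map G X (Obj H Y) f) = k"
  shows "adjoint_pair A B G H"
proof -
  interpret G: cat_functor A B G by (rule G)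
  interpret H: cat_functor B A H by (rule H)
  define \<psi> where "\<psi> X Y f =
    Comp B (Obj G X) (Obj G (Obj H Y)) Y (\<theta> Y) (Map G X (Obj H Y) f)" for X Y f
  define \<phi> where "\<phi> X Y k = (THE f. f \<in> Hom A X (Obj H Y) \<and> \<psi> X Y f = k)" for X Y k
  have mem: "\<psi> X Y f \<in> Hom B (Obj G X) Y"
    if "X \<in> Ob A" "Y \<in> Ob B" "f \<in> Hom A X (Obj H Y)" for X Y f
    unfolding \<psi>_def using that by (intro G.B.Comp_closed counit G.Map_closed G.Obj_closed H.Obj_closed)
  have \<phi>: "\<phi> X Y k \<in> Hom A X (Obj H Y) \<and> \<psi> X Y (\<phi> X Y k) = k"
    if "X \<in> Ob A" "Y \<in> Ob B" "k \<in> Hom B (Obj G X) Y" for X Y k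
    unfolding \<phi>_def by (rule theI') (rule universal[OF that, folded \<psi>_def])
  have \<phi>_eqI: "\<phi> X Y k = f"
    if "X \<in> Ob A" "Y \<in> Ob B" "f \<in> Hom A X (Obj H Y)" "\<psi> X Y f = k" for X Y k f
    using ex1_iff_ex_Uniq[THEN iffD1, THEN conjunct2, THEN Uniq_D,
        OF universal[OF that(1,2) mem[OF that(1-3)], folded \<psi>_def]
           \<phi>[OF that(1,2) mem[OF that(1-3)]]] that(3,4) by simp
  have bij: "bij_betw (\<phi> X Y) (Hom B (Obj G X) Y) (Hom A X (Obj H Y))"
    if "X \<in> Ob A" "Y \<in> Ob B" for X Y
    by (rule bij_betw_byWitness[where f' = "\<psi> X Y"])
      (use that mem \<phi> \<phi>_eqI in \<open>auto simp: image_subset_iff\<close>)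
  have left: "\<phi> X' Y (Comp B (Obj G X') (Obj G X) Y k (Map G X' X a))
      = Comp A X' X (Obj H Y) (\<phi> X Y k) a"
    if X: "X \<in> Ob A" and X': "X' \<in> Ob A" and Y: "Y \<in> Ob B"
      and a: "a \<in> Hom A X' X" and k: "k \<in> Hom B (Obj G X) Y" for X X' Y a k
  proof (rule \<phi>_eqI[OF X' Y])
    define f where "f = \<phi> X Y k"
    have f: "f \<in> Hom A X (Obj H Y)" "\<psi> X Y f = k" using \<phi>[OF X Y k] by (auto simp: f_def)
    show "Comp A X' X (Obj H Y) (\<phi> X Y k) a \<in> Hom A X' (Obj H Y)"
      using X X' Y a f by (simp add: f_def[symmetric] G.A.Comp_closed H.Obj_closed)
    show "\<psi> X' Y (Comp A X' X (Obj H Y) (\<phi> X Y k) a)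
        = Comp B (Obj G X') (Obj G X) Y k (Map G X' X a)"
      unfolding f_def[symmetric] unfolding f(2)[symmetric] unfolding \<psi>_def using X X' Y a f(1)
      by (simp add: G.Map_Comp G.Obj_closed H.Obj_closed G.Map_closed counit
          G.B.Comp_assoc[of "Obj G X'" "Obj G X" "Obj G (Obj H Y)" Y])
  qed
  have right: "\<phi> X Y' (Comp B (Obj G X) Y Y' b k)
      = Comp A X (Obj H Y) (Obj H Y') (Map H Y Y' b) (\<phi> X Y k)"
    if X: "X \<in> Ob A" and Y: "Y \<in> Ob B" and Y': "Y' \<in> Ob B"
      and b: "b \<in> Hom B Y Y'" and k: "k \<in> Hom B (Obj G X) Y" for X Y Y' b k
  proof (rule \<phi>_eqI[OF X Y'])
    define f where "f = \<phi> X Y k"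
    have f: "f \<in> Hom A X (Obj H Y)" "\<psi> X Y f = k" using \<phi>[OF X Y k] by (auto simp: f_def)
    show "Comp A X (Obj H Y) (Obj H Y') (Map H Y Y' b) (\<phi> X Y k) \<in> Hom A X (Obj H Y')"
      using X Y Y' b f by (simp add: f_def[symmetric] G.A.Comp_closed H.Obj_closed H.Map_closed)
    show "\<psi> X Y' (Comp A X (Obj H Y) (Obj H Y') (Map H Y Y' b) (\<phi> X Y k))
        = Comp B (Obj G X) Y Y' b k"
      unfolding f_def[symmetric] unfolding f(2)[symmetric] unfolding \<psi>_def using X Y Y' b f(1)
      by (simp add: G.Map_Comp[of X "Obj H Y" "Obj H Y'"] G.Obj_closed H.Obj_closed G.Map_closed
          H.Map_closed counit natural
          G.B.Comp_assoc[of "Obj G X" "Obj G (Obj H Y)" "Obj G (Obj H Y')" Y']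
          G.B.Comp_assoc[of "Obj G X" "Obj G (Obj H Y)" Y Y'])
  qed
  show ?thesis
    unfolding adjoint_pair_def
    by (intro conjI exI[of _ \<phi>] ballI G H bij left right)
qed

section \<open>Sums of morphisms and nilpotent endomorphisms\<close>

lemma hom_group_simps [simp]:
  "carrier (hom_group C X Y) = Hom C X Y"
  "mult (hom_group C X Y) = Add C X Y"
  "one (hom_group C X Y) = Zero C X Y"
  by (simp_all add: hom_group_def)

lemma hom_finprod_comm_group:
  assumes G: "comm_group G" and H: "comm_group H" and h: "h \<in> hom G H"
    and f: "f \<in> A \<rightarrow> carrier G"
  shows "h (finprod G f A) = finprod H (\<lambda>i. h (f i)) A"
proof -
  interpret G: comm_group G by (rule G)
  interpret H: comm_group H by (rule H)
  interpret group_hom G H h using h by unfold_locales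
  show ?thesis
    using f by (induct A rule: infinite_finite_induct) (auto simp: Pi_def)
qed

context additive_category
begin

lemma Zero_closed: "\<lbrakk>X \<in> Ob C; Y \<in> Ob C\<rbrakk> \<Longrightarrow> Zero C X Y \<in> Hom C X Y"
  using comm_group.axioms(2)[OF hom_comm_group, THEN group.is_monoid, THEN monoid.one_closed, of X Y]
  by simp

text \<open>
  Biadditivity of composition in the language of group homomorphisms, so that compatibility with
  zero and with finite sums follows from general facts about homomorphisms.
\<close>

lemma hom_Comp_left:
  assumes "X \<in> Ob C" "Y \<in> Ob C" "Z \<in> Ob C" "g \<in> Hom C Y Z"
  shows "Comp C X Y Z g \<in> hom (hom_group C X Y) (hom_group C X Z)"
  using assms by (auto simp: hom_def Comp_closed Comp_Add_right)

lemma hom_Comp_right: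
  assumes "X \<in> Ob C" "Y \<in> Ob C" "Z \<in> Ob C" "f \<in> Hom C X Y"
  shows "(\<lambda>g. Comp C X Y Z g f) \<in> hom (hom_group C Y Z) (hom_group C X Z)"
  using assms by (auto simp: hom_def Comp_closed Comp_Add_left)

lemma Comp_Zero_right:
  assumes "X \<in> Ob C" "Y \<in> Ob C" "Z \<in> Ob C" "g \<in> Hom C Y Z"
  shows "Comp C X Y Z g (Zero C X Y) = Zero C X Z"
  using hom_one[OF hom_Comp_left[OF assms]] assms
  by (simp add: comm_group.axioms(2)[OF hom_comm_group])

lemma Comp_Zero_left:
  assumes "X \<in> Ob C" "Y \<in> Ob C" "Z \<in> Ob C" "f \<in> Hom C X Y"
  shows "Comp C X Y Z (Zero C Y Z) f = Zero C X Z"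
  using hom_one[OF hom_Comp_right[OF assms]] assms
  by (simp add: comm_group.axioms(2)[OF hom_comm_group])

lemma sum_closed:
  assumes "X \<in> Ob C" "Y \<in> Ob C" "f \<in> A \<rightarrow> Hom C X Y"
  shows "finprod (hom_group C X Y) f A \<in> Hom C X Y"
  using comm_monoid.finprod_closed[OF comm_group.axioms(1)[OF hom_comm_group[OF assms(1,2)]], of f A]
    assms by simp

lemma Comp_sum_right:
  assumes "X \<in> Ob C" "Y \<in> Ob C" "Z \<in> Ob C" "g \<in> Hom C Y Z" "f \<in> A \<rightarrow> Hom C X Y"
  shows "Comp C X Y Z g (finprod (hom_group C X Y) f A)
    = finprod (hom_group C X Z) (\<lambda>i. Comp C X Y Z g (f i)) A"
  using hom_finprod_comm_group[OF hom_comm_group hom_comm_group hom_Comp_left] assms by simp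

lemma Comp_sum_left:
  assumes "X \<in> Ob C" "Y \<in> Ob C" "Z \<in> Ob C" "f \<in> Hom C X Y" "g \<in> A \<rightarrow> Hom C Y Z"
  shows "Comp C X Y Z (finprod (hom_group C Y Z) g A) f
    = finprod (hom_group C X Z) (\<lambda>i. Comp C X Y Z (g i) f) A"
  using hom_finprod_comm_group[OF hom_comm_group hom_comm_group hom_Comp_right] assms by simp

lemma sum_cong:
  assumes "X \<in> Ob C" "Y \<in> Ob C" "\<And>i. i \<in> A \<Longrightarrow> f i = g i" "g \<in> A \<rightarrow> Hom C X Y"
  shows "finprod (hom_group C X Y) f A = finprod (hom_group C X Y) g A"
  by (rule comm_monoid.finprod_cong'[OF comm_group.axioms(1)[OF hom_comm_group[OF assms(1,2)]]])
    (use assms in auto)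

lemma sum_delta:
  assumes "X \<in> Ob C" "Y \<in> Ob C" "finite A" "i \<in> A" "f i \<in> Hom C X Y"
  shows "finprod (hom_group C X Y) (\<lambda>j. if i = j then f i else Zero C X Y) A = f i"
  using comm_monoid.finprod_singleton[OF comm_group.axioms(1)[OF hom_comm_group[OF assms(1,2)]]
      assms(4,3), of "\<lambda>_. f i", unfolded hom_group_simps] assms by simp

end

abbreviation endo_pow :: "('o, 'm, 'x) cat_scheme \<Rightarrow> 'o \<Rightarrow> 'm \<Rightarrow> nat \<Rightarrow> 'm" where
  "endo_pow C X e k \<equiv> e [^]\<^bsub>End_monoid C X\<^esub> k"

context category
begin

lemma monoid_End: "X \<in> Ob C \<Longrightarrow> monoid (End_monoid C X)"
  by unfold_locales
    (auto simp: End_monoid_def Id_closed Comp_closed Comp_Id_left Comp_Id_right Comp_assoc)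

lemma endo_pow_closed: "\<lbrakk>X \<in> Ob C; e \<in> Hom C X X\<rbrakk> \<Longrightarrow> endo_pow C X e k \<in> Hom C X X"
  using monoid.nat_pow_closed[OF monoid_End, of X e k] by (simp add: End_monoid_def)

lemma one_End_monoid: "\<one>\<^bsub>End_monoid C X\<^esub> = Id C X"
  by (simp add: End_monoid_def)

lemma endo_pow_Suc: "endo_pow C X e (Suc k) = Comp C X X X (endo_pow C X e k) e"
  by (simp add: End_monoid_def nat_pow_def)

lemma endo_pow_Suc2:
  "\<lbrakk>X \<in> Ob C; e \<in> Hom C X X\<rbrakk> \<Longrightarrow> endo_pow C X e (Suc k) = Comp C X X X e (endo_pow C X e k)"
  using monoid.nat_pow_Suc2[OF monoid_End, of X e k] by (simp add: End_monoid_def)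

end

lemma Ob_eps_cat: "(X, e) \<in> Ob (eps_cat C n) \<longleftrightarrow>
    X \<in> Ob C \<and> e \<in> Hom C X X \<and> endo_pow C X e n = Zero C X X"
  by (simp add: eps_cat_def)

lemma Hom_eps_cat: "f \<in> Hom (eps_cat C n) (X, e) (Y, d) \<longleftrightarrow>
    f \<in> Hom C X Y \<and> Comp C X X Y f e = Comp C X Y Y d f"
  by (simp add: eps_cat_def)

lemma Id_eps_cat: "Id (eps_cat C n) (X, e) = Id C X"
  by (simp add: eps_cat_def)

lemma Comp_eps_cat: "Comp (eps_cat C n) (X, e) (Y, d) (Z, c) = Comp C X Y Z"
  by (simp add: eps_cat_def)

lemmas eps_cat_simps = Ob_eps_cat Hom_eps_cat Id_eps_cat Comp_eps_cat

lemma (in additive_category) category_eps_cat: "category (eps_cat C n)"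
proof (unfold_locales, goal_cases)
  case (1 X) then show ?case by (cases X) (simp add: eps_cat_simps Id_closed Comp_Id_left Comp_Id_right)
next
  case (2 X Y Z f g)
  obtain X' e Y' d Z' c where [simp]: "X = (X', e)" "Y = (Y', d)" "Z = (Z', c)"
    by (metis surj_pair)
  have o: "X' \<in> Ob C" "Y' \<in> Ob C" "Z' \<in> Ob C" "e \<in> Hom C X' X'" "d \<in> Hom C Y' Y'" "c \<in> Hom C Z' Z'"
    and f: "f \<in> Hom C X' Y'" "Comp C X' X' Y' f e = Comp C X' Y' Y' d f"
    and g: "g \<in> Hom C Y' Z'" "Comp C Y' Y' Z' g d = Comp C Y' Z' Z' c g"
    using 2 by (simp_all add: eps_cat_simps)
  have "Comp C X' X' Z' (Comp C X' Y' Z' g f) e = Comp C X' Y' Z' g (Comp C X' X' Y' f e)"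
    using o f(1) g(1) by (simp only: Comp_assoc)
  also have "\<dots> = Comp C X' Y' Z' (Comp C Y' Y' Z' g d) f"
    using o f(1) g(1) by (simp only: f(2) g(2)[symmetric] Comp_assoc)
  also have "\<dots> = Comp C X' Z' Z' c (Comp C X' Y' Z' g f)"
    using o f(1) g(1) by (simp only: g(2) Comp_assoc)
  finally show ?case using o f g by (simp add: eps_cat_simps Comp_closed)
next
  case (3 X Y f) then show ?case by (cases X; cases Y) (simp add: eps_cat_simps Comp_Id_right)
next
  case (4 X Y f) then show ?case by (cases X; cases Y) (simp add: eps_cat_simps Comp_Id_left)
next
  case (5 W X Y Z f g h) then show ?case
    by (cases W; cases X; cases Y; cases Z) (simp add: eps_cat_simps Comp_assoc)
qed

lemma (in additive_category) cat_functor_forgetful: "cat_functor (eps_cat C n) C forgetful"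
  by (intro cat_functor.intro category_eps_cat category_axioms cat_functor_axioms.intro)
    (auto simp: forgetful_def eps_cat_simps)


section \<open>Matrices between biproduct powers\<close>

locale biproduct_power_choice = additive_category C for C :: "('o, 'm, 'x) acat_scheme" +
  fixes n :: nat and P :: "'o \<Rightarrow> 'o" and \<iota> \<pi> :: "'o \<Rightarrow> nat \<Rightarrow> 'm"
  assumes powers: "biproduct_powers C n P \<iota> \<pi>"
begin

lemma P_Ob: "X \<in> Ob C \<Longrightarrow> P X \<in> Ob C"
  and inj_closed: "\<lbrakk>X \<in> Ob C; i \<in> {1..n}\<rbrakk> \<Longrightarrow> \<iota> X i \<in> Hom C X (P X)"
  and proj_closed: "\<lbrakk>X \<in> Ob C; i \<in> {1..n}\<rbrakk> \<Longrightarrow> \<pi> X i \<in> Hom C (P X) X"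
  and proj_inj: "\<lbrakk>X \<in> Ob C; i \<in> {1..n}; j \<in> {1..n}\<rbrakk> \<Longrightarrow>
    Comp C X (P X) X (\<pi> X i) (\<iota> X j) = (if i = j then Id C X else Zero C X X)"
  and sum_inj_proj: "X \<in> Ob C \<Longrightarrow>
    finprod (hom_group C (P X) (P X)) (\<lambda>i. Comp C (P X) X (P X) (\<iota> X i) (\<pi> X i)) {1..n}
      = Id C (P X)"
  using powers by (simp_all add: biproduct_powers_def biproduct_def)

lemmas power_closed = P_Ob inj_closed proj_closed

text \<open>
  Inserting \<open>\<Sum>\<^sub>i \<iota>\<^sub>i \<pi>\<^sub>i = 1\<close> writes every morphism into \<open>X\<^sup>\<oplus>\<^sup>n\<close> in terms of its components. The
  functor laws and the commutation relations with the shift are checked componentwise by means of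
  this lemma and its dual.
\<close>

lemma eq_if_proj_eq:
  assumes X: "X \<in> Ob C" and Z: "Z \<in> Ob C" and f: "f \<in> Hom C Z (P X)" and g: "g \<in> Hom C Z (P X)"
    and eq: "\<And>i. i \<in> {1..n} \<Longrightarrow> Comp C Z (P X) X (\<pi> X i) f = Comp C Z (P X) X (\<pi> X i) g"
  shows "f = g"
proof -
  \<comment> \<open>Every \<open>h : Z \<rightarrow> X\<^sup>\<oplus>\<^sup>n\<close> equals \<open>\<Sum>\<^sub>i \<iota>\<^sub>i (\<pi>\<^sub>i h)\<close>.\<close>
  have expand: "h = finprod (hom_group C Z (P X))
      (\<lambda>i. Comp C Z X (P X) (\<iota> X i) (Comp C Z (P X) X (\<pi> X i) h)) {1..n}"
    if h: "h \<in> Hom C Z (P X)" for h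
  proof -
    have "h = Comp C Z (P X) (P X) (finprod (hom_group C (P X) (P X))
        (\<lambda>i. Comp C (P X) X (P X) (\<iota> X i) (\<pi> X i)) {1..n}) h"
      using X Z h by (simp add: sum_inj_proj P_Ob Comp_Id_left del: One_nat_def)
    also have "\<dots> = finprod (hom_group C Z (P X))
        (\<lambda>i. Comp C Z (P X) (P X) (Comp C (P X) X (P X) (\<iota> X i) (\<pi> X i)) h) {1..n}"
      using X Z h by (intro Comp_sum_left) (auto intro!: Comp_closed power_closed)
    also have "\<dots> = finprod (hom_group C Z (P X))
      (\<lambda>i. Comp C Z X (P X) (\<iota> X i) (Comp C Z (P X) X (\<pi> X i) h)) {1..n}"
      using X Z h by (intro sum_cong)
        (auto intro!: Comp_closed power_closed Comp_assoc[symmetric])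
    finally show ?thesis .
  qed
  have "f = finprod (hom_group C Z (P X))
      (\<lambda>i. Comp C Z X (P X) (\<iota> X i) (Comp C Z (P X) X (\<pi> X i) f)) {1..n}"
    by (rule expand[OF f])
  also have "\<dots> = finprod (hom_group C Z (P X))
      (\<lambda>i. Comp C Z X (P X) (\<iota> X i) (Comp C Z (P X) X (\<pi> X i) g)) {1..n}"
    using X Z g by (intro sum_cong) (auto simp: eq intro!: Comp_closed power_closed)
  also have "\<dots> = g"
    by (rule expand[OF g, symmetric])
  finally show ?thesis .
qed

lemma eq_if_inj_eq:
  assumes X: "X \<in> Ob C" and Z: "Z \<in> Ob C" and f: "f \<in> Hom C (P X) Z" and g: "g \<in> Hom C (P X) Z"
    and eq: "\<And>i. i \<in> {1..n} \<Longrightarrow> Comp C X (P X) Z f (\<iota> X i) = Comp C X (P X) Z g (\<iota> X i)"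
  shows "f = g"
proof -
  have expand: "h = finprod (hom_group C (P X) Z)
      (\<lambda>i. Comp C (P X) X Z (Comp C X (P X) Z h (\<iota> X i)) (\<pi> X i)) {1..n}"
    if h: "h \<in> Hom C (P X) Z" for h
  proof -
    have "h = Comp C (P X) (P X) Z h (finprod (hom_group C (P X) (P X))
        (\<lambda>i. Comp C (P X) X (P X) (\<iota> X i) (\<pi> X i)) {1..n})"
      using X Z h by (simp add: sum_inj_proj P_Ob Comp_Id_right del: One_nat_def)
    also have "\<dots> = finprod (hom_group C (P X) Z)
        (\<lambda>i. Comp C (P X) (P X) Z h (Comp C (P X) X (P X) (\<iota> X i) (\<pi> X i))) {1..n}"
      using X Z h by (intro Comp_sum_right) (auto intro!: Comp_closed power_closed)
    also have "\<dots> = finprod (hom_group C (P X) Z)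
      (\<lambda>i. Comp C (P X) X Z (Comp C X (P X) Z h (\<iota> X i)) (\<pi> X i)) {1..n}"
      using X Z h by (intro sum_cong)
        (auto intro!: Comp_closed power_closed Comp_assoc)
    finally show ?thesis .
  qed
  have "f = finprod (hom_group C (P X) Z)
      (\<lambda>i. Comp C (P X) X Z (Comp C X (P X) Z f (\<iota> X i)) (\<pi> X i)) {1..n}"
    by (rule expand[OF f])
  also have "\<dots> = finprod (hom_group C (P X) Z)
      (\<lambda>i. Comp C (P X) X Z (Comp C X (P X) Z g (\<iota> X i)) (\<pi> X i)) {1..n}"
    using X Z g by (intro sum_cong) (auto simp: eq intro!: Comp_closed power_closed)
  also have "\<dots> = g"
    by (rule expand[OF g, symmetric])
  finally show ?thesis .
qed

text \<open>
  A biproduct power is a product and a coproduct: the morphism with components \<open>f\<^sub>i\<close> is \<open>\<Sum>\<^sub>i \<iota>\<^sub>i f\<^sub>i\<close> in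
  the first case and \<open>\<Sum>\<^sub>i f\<^sub>i \<pi>\<^sub>i\<close> in the second.
\<close>

lemma obtain_into_power:
  assumes X: "X \<in> Ob C" and Z: "Z \<in> Ob C" and f: "\<And>i. i \<in> {1..n} \<Longrightarrow> f i \<in> Hom C Z X"
  obtains g where "g \<in> Hom C Z (P X)"
    "\<And>i. i \<in> {1..n} \<Longrightarrow> Comp C Z (P X) X (\<pi> X i) g = f i"
proof
  let ?g = "finprod (hom_group C Z (P X)) (\<lambda>j. Comp C Z X (P X) (\<iota> X j) (f j)) {1..n}"
  show "?g \<in> Hom C Z (P X)"
    using X Z f by (intro sum_closed) (auto intro!: Comp_closed power_closed)
  fix i assume i: "i \<in> {1..n}"
  have "Comp C Z (P X) X (\<pi> X i) ?g = finprod (hom_group C Z X)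
      (\<lambda>j. Comp C Z (P X) X (\<pi> X i) (Comp C Z X (P X) (\<iota> X j) (f j))) {1..n}"
    using X Z f i by (intro Comp_sum_right) (auto intro!: Comp_closed power_closed)
  also have "\<dots> = finprod (hom_group C Z X) (\<lambda>j. if i = j then f i else Zero C Z X) {1..n}"
    using X Z f i by (intro sum_cong)
      (auto simp: Comp_assoc[of Z X "P X" X] power_closed proj_inj Comp_Id_left Comp_Zero_left Zero_closed)
  also have "\<dots> = f i"
    using X Z f i by (intro sum_delta) auto
  finally show "Comp C Z (P X) X (\<pi> X i) ?g = f i" .
qed

lemma obtain_from_power:
  assumes X: "X \<in> Ob C" and Z: "Z \<in> Ob C" and f: "\<And>i. i \<in> {1..n} \<Longrightarrow> f i \<in> Hom C X Z"
  obtains g where "g \<in> Hom C (P X) Z"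
    "\<And>i. i \<in> {1..n} \<Longrightarrow> Comp C X (P X) Z g (\<iota> X i) = f i"
proof
  let ?g = "finprod (hom_group C (P X) Z) (\<lambda>j. Comp C (P X) X Z (f j) (\<pi> X j)) {1..n}"
  show "?g \<in> Hom C (P X) Z"
    using X Z f by (intro sum_closed) (auto intro!: Comp_closed power_closed)
  fix i assume i: "i \<in> {1..n}"
  have "Comp C X (P X) Z ?g (\<iota> X i) = finprod (hom_group C X Z)
      (\<lambda>j. Comp C X (P X) Z (Comp C (P X) X Z (f j) (\<pi> X j)) (\<iota> X i)) {1..n}"
    using X Z f i by (intro Comp_sum_left) (auto intro!: Comp_closed power_closed)
  also have "\<dots> = finprod (hom_group C X Z) (\<lambda>j. if i = j then f i else Zero C X Z) {1..n}"
    using X Z f i by (intro sum_cong)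
      (auto simp: Comp_assoc[of X "P X" X Z, symmetric] power_closed proj_inj Comp_Id_right
        Comp_Zero_right Zero_closed)
  also have "\<dots> = f i"
    using X Z f i by (intro sum_delta) auto
  finally show "Comp C X (P X) Z ?g (\<iota> X i) = f i" .
qed

lemma matrix_mor_closed:
  assumes "X \<in> Ob C" "Y \<in> Ob C" "\<And>i j. i \<in> {1..n} \<Longrightarrow> j \<in> {1..n} \<Longrightarrow> a i j \<in> Hom C X Y"
  shows "matrix_mor C n P \<iota> \<pi> X Y a \<in> Hom C (P X) (P Y)"
  unfolding matrix_mor_def
  using assms by (intro sum_closed) (auto intro!: Comp_closed power_closed)

text \<open>
  In \<open>\<pi>\<^sub>i (\<Sum>\<^bsub>k,l\<^esub> \<iota>\<^sub>k a\<^bsub>kl\<^esub> \<pi>\<^sub>l) \<iota>\<^sub>j\<close> the orthogonality relations \<open>\<pi>\<^sub>i \<iota>\<^sub>k = \<delta>\<^bsub>ik\<^esub>\<close> and \<open>\<pi>\<^sub>l \<iota>\<^sub>j = \<delta>\<^bsub>lj\<^esub>\<close> leave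
  only the summand with index \<open>(i, j)\<close>.
\<close>

lemma matrix_mor_entry:
  assumes X: "X \<in> Ob C" and Y: "Y \<in> Ob C"
    and a: "\<And>i j. i \<in> {1..n} \<Longrightarrow> j \<in> {1..n} \<Longrightarrow> a i j \<in> Hom C X Y"
    and i: "i \<in> {1..n}" and j: "j \<in> {1..n}"
  shows "Comp C X (P X) Y (Comp C (P X) (P Y) Y (\<pi> Y i) (matrix_mor C n P \<iota> \<pi> X Y a)) (\<iota> X j) = a i j"
proof -
  let ?t = "\<lambda>(k, l). Comp C (P X) Y (P Y) (\<iota> Y k) (Comp C (P X) X Y (a k l) (\<pi> X l))"
  have t: "?t p \<in> Hom C (P X) (P Y)" if "p \<in> {1..n} \<times> {1..n}" for p
    using that X Y a by (auto intro!: Comp_closed power_closed)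
  have summand: "Comp C X (P X) Y (Comp C (P X) (P Y) Y (\<pi> Y i) (?t p)) (\<iota> X j)
      = (if (i, j) = p then a i j else Zero C X Y)" if "p \<in> {1..n} \<times> {1..n}" for p
  proof -
    from that obtain k l where p: "p = (k, l)" and k: "k \<in> {1..n}" and l: "l \<in> {1..n}"
      by (cases p) auto
    have "Comp C X (P X) Y (Comp C (P X) (P Y) Y (\<pi> Y i) (?t p)) (\<iota> X j)
        = Comp C X Y Y (Comp C Y (P Y) Y (\<pi> Y i) (\<iota> Y k))
            (Comp C X X Y (a k l) (Comp C X (P X) X (\<pi> X l) (\<iota> X j)))"
      unfolding p using X Y a[OF k l] i j k l
      by (simp add: Comp_assoc power_closed Comp_closed del: atLeastAtMost_iff)
    also have "\<dots> = (if (i, j) = p then a i j else Zero C X Y)"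
      unfolding p using X Y a[OF k l] i j k l
      by (auto simp: proj_inj Comp_Id_left Comp_Id_right Comp_Zero_left Comp_Zero_right
          Id_closed Zero_closed Comp_closed)
    finally show ?thesis .
  qed
  have "Comp C X (P X) Y (Comp C (P X) (P Y) Y (\<pi> Y i) (matrix_mor C n P \<iota> \<pi> X Y a)) (\<iota> X j)
      = finprod (hom_group C X Y)
          (\<lambda>p. Comp C X (P X) Y (Comp C (P X) (P Y) Y (\<pi> Y i) (?t p)) (\<iota> X j)) ({1..n} \<times> {1..n})"
    unfolding matrix_mor_def using X Y i j t
    by (subst Comp_sum_right, simp_all add: power_closed Pi_iff)
      (subst Comp_sum_left, simp_all add: power_closed Pi_iff Comp_closed)
  also have "\<dots> = finprod (hom_group C X Y)
      (\<lambda>p. if (i, j) = p then (\<lambda>(k, l). a k l) (i, j) else Zero C X Y) ({1..n} \<times> {1..n})"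
    using X Y a i j by (intro sum_cong) (auto simp: summand Zero_closed)
  also have "\<dots> = (\<lambda>(k, l). a k l) (i, j)"
    using X Y a i j by (intro sum_delta) auto
  finally show ?thesis by simp
qed

section \<open>The augmenting functor\<close>

definition shift :: "'o \<Rightarrow> 'm" where
  "shift X = matrix_mor C n P \<iota> \<pi> X X (\<lambda>i j. if i = j + 1 then Id C X else Zero C X X)"

definition diag :: "'o \<Rightarrow> 'o \<Rightarrow> 'm \<Rightarrow> 'm" where
  "diag X Y f = matrix_mor C n P \<iota> \<pi> X Y (\<lambda>i j. if i = j then f else Zero C X Y)"

abbreviation T :: "('o, 'm, 'o \<times> 'm, 'm) func" where
  "T \<equiv> augmenting C n P \<iota> \<pi>"

lemma shift_closed: "X \<in> Ob C \<Longrightarrow> shift X \<in> Hom C (P X) (P X)"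
  unfolding shift_def by (rule matrix_mor_closed) (auto simp: Id_closed Zero_closed)

lemma diag_closed: "\<lbrakk>X \<in> Ob C; Y \<in> Ob C; f \<in> Hom C X Y\<rbrakk> \<Longrightarrow> diag X Y f \<in> Hom C (P X) (P Y)"
  unfolding diag_def by (rule matrix_mor_closed) (auto simp: Zero_closed)

text \<open>
  Row \<open>i\<close> of the shift matrix has its only nonzero entry in column \<open>i - 1\<close>, and column \<open>j\<close> has it in
  row \<open>j + 1\<close>.
\<close>

lemma proj_shift:
  assumes X: "X \<in> Ob C" and i: "i \<in> {1..n}"
  shows "Comp C (P X) (P X) X (\<pi> X i) (shift X) = (if i = 1 then Zero C (P X) X else \<pi> X (i - 1))"
proof (rule eq_if_inj_eq[OF X X])
  fix j assume j: "j \<in> {1..n}"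
  have "Comp C X (P X) X (Comp C (P X) (P X) X (\<pi> X i) (shift X)) (\<iota> X j)
      = (if i = j + 1 then Id C X else Zero C X X)"
    unfolding shift_def using X i j by (intro matrix_mor_entry) (auto simp: Id_closed Zero_closed)
  also have "\<dots> = Comp C X (P X) X (if i = 1 then Zero C (P X) X else \<pi> X (i - 1)) (\<iota> X j)"
  proof (cases "i = 1")
    case True
    with X j show ?thesis by (simp add: Comp_Zero_left power_closed)
  next
    case False
    then have "i - 1 \<in> {1..n}" "i = j + 1 \<longleftrightarrow> i - 1 = j" using i by auto
    with False show ?thesis using X j by (simp only: proj_inj if_False)
  qed
  finally show "Comp C X (P X) X (Comp C (P X) (P X) X (\<pi> X i) (shift X)) (\<iota> X j)
    = Comp C X (P X) X (if i = 1 then Zero C (P X) X else \<pi> X (i - 1)) (\<iota> X j)" .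
qed (use X i in \<open>auto intro!: Comp_closed power_closed shift_closed Zero_closed\<close>)

lemma shift_inj:
  assumes X: "X \<in> Ob C" and j: "j \<in> {1..n}"
  shows "Comp C X (P X) (P X) (shift X) (\<iota> X j) = (if j = n then Zero C X (P X) else \<iota> X (j + 1))"
proof (rule eq_if_proj_eq[OF X X])
  fix i assume i: "i \<in> {1..n}"
  have "Comp C X (P X) X (\<pi> X i) (Comp C X (P X) (P X) (shift X) (\<iota> X j))
      = Comp C X (P X) X (Comp C (P X) (P X) X (\<pi> X i) (shift X)) (\<iota> X j)"
    using X i j by (simp only: Comp_assoc power_closed shift_closed)
  also have "\<dots> = (if i = j + 1 then Id C X else Zero C X X)"
    unfolding shift_def using X i j by (intro matrix_mor_entry) (auto simp: Id_closed Zero_closed)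
  also have "\<dots> = Comp C X (P X) X (\<pi> X i) (if j = n then Zero C X (P X) else \<iota> X (j + 1))"
  proof (cases "j = n")
    case True
    with X i show ?thesis by (simp add: Comp_Zero_right power_closed)
  next
    case False
    then have "j + 1 \<in> {1..n}" using j by auto
    with False show ?thesis using X i by (simp only: proj_inj if_False)
  qed
  finally show "Comp C X (P X) X (\<pi> X i) (Comp C X (P X) (P X) (shift X) (\<iota> X j))
    = Comp C X (P X) X (\<pi> X i) (if j = n then Zero C X (P X) else \<iota> X (j + 1))" .
qed (use X j in \<open>auto intro!: Comp_closed power_closed shift_closed Zero_closed\<close>)

text \<open>
  The next two lemmas are the naturality of the projections and of the injections with respect to
  the augmenting functor; for \<open>\<pi>\<^sub>n\<close> and \<open>\<iota>\<^sub>1\<close> they give the naturality of the counit and of the unit.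
\<close>

lemma proj_diag:
  assumes X: "X \<in> Ob C" and Y: "Y \<in> Ob C" and f: "f \<in> Hom C X Y" and i: "i \<in> {1..n}"
  shows "Comp C (P X) (P Y) Y (\<pi> Y i) (diag X Y f) = Comp C (P X) X Y f (\<pi> X i)"
proof (rule eq_if_inj_eq[OF X Y])
  fix j assume j: "j \<in> {1..n}"
  have "Comp C X (P X) Y (Comp C (P X) (P Y) Y (\<pi> Y i) (diag X Y f)) (\<iota> X j)
      = (if i = j then f else Zero C X Y)"
    unfolding diag_def using X Y f i j by (intro matrix_mor_entry) (auto simp: Zero_closed)
  also have "\<dots> = Comp C X (P X) Y (Comp C (P X) X Y f (\<pi> X i)) (\<iota> X j)"
    using X Y f i j
    by (auto simp: Comp_assoc[of X "P X" X Y, symmetric] proj_inj Comp_Id_right Comp_Zero_right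
        power_closed)
  finally show "Comp C X (P X) Y (Comp C (P X) (P Y) Y (\<pi> Y i) (diag X Y f)) (\<iota> X j)
    = Comp C X (P X) Y (Comp C (P X) X Y f (\<pi> X i)) (\<iota> X j)" .
qed (use X Y f i in \<open>auto intro!: Comp_closed power_closed diag_closed\<close>)

lemma diag_inj:
  assumes X: "X \<in> Ob C" and Y: "Y \<in> Ob C" and f: "f \<in> Hom C X Y" and j: "j \<in> {1..n}"
  shows "Comp C X (P X) (P Y) (diag X Y f) (\<iota> X j) = Comp C X Y (P Y) (\<iota> Y j) f"
proof (rule eq_if_proj_eq[OF Y X])
  fix i assume i: "i \<in> {1..n}"
  have "Comp C X (P Y) Y (\<pi> Y i) (Comp C X (P X) (P Y) (diag X Y f) (\<iota> X j))
      = Comp C X (P X) Y (Comp C (P X) (P Y) Y (\<pi> Y i) (diag X Y f)) (\<iota> X j)"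
    using X Y f i j by (simp only: Comp_assoc power_closed diag_closed)
  also have "\<dots> = (if i = j then f else Zero C X Y)"
    unfolding diag_def using X Y f i j by (intro matrix_mor_entry) (auto simp: Zero_closed)
  also have "\<dots> = Comp C X (P Y) Y (\<pi> Y i) (Comp C X Y (P Y) (\<iota> Y j) f)"
    using X Y f i j
    by (auto simp: Comp_assoc[of X Y "P Y" Y] proj_inj Comp_Id_left Comp_Zero_left power_closed)
  finally show "Comp C X (P Y) Y (\<pi> Y i) (Comp C X (P X) (P Y) (diag X Y f) (\<iota> X j))
    = Comp C X (P Y) Y (\<pi> Y i) (Comp C X Y (P Y) (\<iota> Y j) f)" .
qed (use X Y f j in \<open>auto intro!: Comp_closed power_closed diag_closed\<close>)

text \<open>
  Each factor \<open>S\<close> lowers the index of the projection by one until it reaches \<open>0\<close>, so after \<open>n\<close> factors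
  every component is zero; this gives \<open>S\<^sup>n = 0\<close>.
\<close>

lemma proj_shift_pow:
  assumes X: "X \<in> Ob C" and i: "i \<in> {1..n}"
  shows "Comp C (P X) (P X) X (\<pi> X i) (endo_pow C (P X) (shift X) k)
    = (if i \<le> k then Zero C (P X) X else \<pi> X (i - k))"
proof (induction k)
  case 0
  show ?case using X i by (auto simp: one_End_monoid Comp_Id_right power_closed)
next
  case (Suc k)
  have "Comp C (P X) (P X) X (\<pi> X i) (endo_pow C (P X) (shift X) (Suc k))
      = Comp C (P X) (P X) X (Comp C (P X) (P X) X (\<pi> X i) (endo_pow C (P X) (shift X) k)) (shift X)"
    using X i by (simp only: endo_pow_Suc Comp_assoc power_closed shift_closed endo_pow_closed)
  also have "\<dots> = (if i \<le> Suc k then Zero C (P X) X else \<pi> X (i - Suc k))"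
  proof (cases "i \<le> k")
    case True
    then show ?thesis using X Suc by (simp add: Comp_Zero_left power_closed shift_closed)
  next
    case False
    then have "i - k \<in> {1..n}" "i - k = 1 \<longleftrightarrow> i \<le> Suc k" "i - k - 1 = i - Suc k" using i by auto
    with False show ?thesis using X by (simp only: Suc proj_shift if_False)
  qed
  finally show ?case .
qed

lemma shift_nilpotent:
  assumes X: "X \<in> Ob C"
  shows "endo_pow C (P X) (shift X) n = Zero C (P X) (P X)"
  by (rule eq_if_proj_eq[OF X P_Ob[OF X]])
    (use X in \<open>auto simp: proj_shift_pow Comp_Zero_right power_closed endo_pow_closed shift_closed
      Zero_closed\<close>)

text \<open>
  Both sides have \<open>i\<close>-th component \<open>f \<pi>\<^bsub>i-1\<^esub>\<close>, or \<open>0\<close> if \<open>i = 1\<close>; thus \<open>T f\<close> is a morphism in the category of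
  nilpotent endomorphisms.
\<close>

lemma diag_shift:
  assumes X: "X \<in> Ob C" and Y: "Y \<in> Ob C" and f: "f \<in> Hom C X Y"
  shows "Comp C (P X) (P X) (P Y) (diag X Y f) (shift X)
    = Comp C (P X) (P Y) (P Y) (shift Y) (diag X Y f)"
proof (rule eq_if_proj_eq[OF Y P_Ob[OF X]])
  fix i assume i: "i \<in> {1..n}"
  have "Comp C (P X) (P Y) Y (\<pi> Y i) (Comp C (P X) (P X) (P Y) (diag X Y f) (shift X))
      = Comp C (P X) (P X) Y (Comp C (P X) X Y f (\<pi> X i)) (shift X)"
    using X Y f i by (simp only: Comp_assoc power_closed diag_closed shift_closed proj_diag)
  also have "\<dots> = Comp C (P X) X Y f (if i = 1 then Zero C (P X) X else \<pi> X (i - 1))"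
    using X Y f i
    by (simp only: Comp_assoc[of "P X" "P X" X Y, symmetric] power_closed shift_closed proj_shift)
  also have "\<dots> = Comp C (P X) (P Y) Y (if i = 1 then Zero C (P Y) Y else \<pi> Y (i - 1)) (diag X Y f)"
  proof (cases "i = 1")
    case True
    with X Y f show ?thesis by (simp add: Comp_Zero_left Comp_Zero_right P_Ob diag_closed)
  next
    case False
    then have "i - 1 \<in> {1..n}" using i by auto
    with False show ?thesis using X Y f by (simp only: proj_diag if_False)
  qed
  also have "\<dots> = Comp C (P X) (P Y) Y (\<pi> Y i) (Comp C (P X) (P Y) (P Y) (shift Y) (diag X Y f))"
    using X Y f i
    by (simp only: Comp_assoc[of "P X" "P Y" "P Y" Y] power_closed diag_closed shift_closed proj_shift)
  finally show "Comp C (P X) (P Y) Y (\<pi> Y i) (Comp C (P X) (P X) (P Y) (diag X Y f) (shift X))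
    = Comp C (P X) (P Y) Y (\<pi> Y i) (Comp C (P X) (P Y) (P Y) (shift Y) (diag X Y f))" .
qed (use X Y f in \<open>auto intro!: Comp_closed P_Ob diag_closed shift_closed\<close>)

lemma diag_Id:
  assumes X: "X \<in> Ob C"
  shows "diag X X (Id C X) = Id C (P X)"
  by (rule eq_if_proj_eq[OF X P_Ob[OF X]])
    (use X in \<open>simp_all add: proj_diag Id_closed diag_closed Comp_Id_left Comp_Id_right power_closed\<close>)

lemma diag_Comp:
  assumes X: "X \<in> Ob C" and Y: "Y \<in> Ob C" and Z: "Z \<in> Ob C"
    and f: "f \<in> Hom C X Y" and g: "g \<in> Hom C Y Z"
  shows "diag X Z (Comp C X Y Z g f) = Comp C (P X) (P Y) (P Z) (diag Y Z g) (diag X Y f)"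
proof (rule eq_if_proj_eq[OF Z P_Ob[OF X]])
  fix i assume i: "i \<in> {1..n}"
  have "Comp C (P X) (P Z) Z (\<pi> Z i) (diag X Z (Comp C X Y Z g f))
      = Comp C (P X) Y Z g (Comp C (P X) X Y f (\<pi> X i))"
    using X Y Z f g i by (simp only: proj_diag Comp_closed Comp_assoc power_closed)
  also have "\<dots> = Comp C (P X) (P Y) Z (Comp C (P Y) Y Z g (\<pi> Y i)) (diag X Y f)"
    using X Y Z f g i
    by (simp only: proj_diag[symmetric, of X Y] Comp_assoc power_closed diag_closed)
  also have "\<dots> = Comp C (P X) (P Z) Z (\<pi> Z i) (Comp C (P X) (P Y) (P Z) (diag Y Z g) (diag X Y f))"
    using X Y Z f g i
    by (simp only: proj_diag[symmetric, of Y Z] Comp_assoc power_closed diag_closed)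
  finally show "Comp C (P X) (P Z) Z (\<pi> Z i) (diag X Z (Comp C X Y Z g f))
    = Comp C (P X) (P Z) Z (\<pi> Z i) (Comp C (P X) (P Y) (P Z) (diag Y Z g) (diag X Y f))" .
qed (use X Y Z f g in \<open>auto intro!: Comp_closed P_Ob diag_closed\<close>)

lemma augmenting_simps:
  "Obj T X = (P X, shift X)" "Map T X Y f = diag X Y f"
  by (simp_all add: augmenting_def shift_def diag_def)

lemma cat_functor_augmenting: "cat_functor C (eps_cat C n) T"
  by (intro cat_functor.intro category_eps_cat category_axioms cat_functor_axioms.intro)
    (simp_all add: augmenting_simps eps_cat_simps P_Ob shift_closed shift_nilpotent diag_closed
      diag_shift diag_Id diag_Comp)

section \<open>The two adjunctions\<close>

text \<open>
  Iterating \<open>\<pi>\<^bsub>i-1\<^esub> g = \<pi>\<^sub>i S g = (\<pi>\<^sub>i g) e\<close> downwards from \<open>i = n\<close> shows that the last component of a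
  morphism into \<open>T Y\<close> determines all the others.
\<close>

lemma proj_of_eps_morphism:
  assumes X: "X \<in> Ob C" and e: "e \<in> Hom C X X" and Y: "Y \<in> Ob C"
    and g: "g \<in> Hom C X (P Y)" "Comp C X X (P Y) g e = Comp C X (P Y) (P Y) (shift Y) g"
    and m: "m < n"
  shows "Comp C X (P Y) Y (\<pi> Y (n - m)) g
    = Comp C X X Y (Comp C X (P Y) Y (\<pi> Y n) g) (endo_pow C X e m)"
  using m
proof (induction m)
  case 0
  then have "n \<in> {1..n}" by simp
  with X Y g(1) show ?case by (simp add: one_End_monoid Comp_Id_right Comp_closed power_closed)
next
  case (Suc m)
  then have i: "n - m \<in> {1..n}" "n \<in> {1..n}" "n - m \<noteq> 1" and pred: "n - Suc m = n - m - 1" by auto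
  have "Comp C X (P Y) Y (\<pi> Y (n - Suc m)) g
      = Comp C X (P Y) Y (Comp C (P Y) (P Y) Y (\<pi> Y (n - m)) (shift Y)) g"
    using Y i by (simp only: proj_shift pred if_False)
  also have "\<dots> = Comp C X (P Y) Y (\<pi> Y (n - m)) (Comp C X X (P Y) g e)"
    using X Y g i by (simp only: Comp_assoc power_closed shift_closed)
  also have "\<dots> = Comp C X X Y (Comp C X (P Y) Y (\<pi> Y (n - m)) g) e"
    using X Y e g(1) i by (simp only: Comp_assoc power_closed)
  also have "\<dots> = Comp C X X Y
      (Comp C X X Y (Comp C X (P Y) Y (\<pi> Y n) g) (endo_pow C X e m)) e"
    using Suc by simp
  also have "\<dots> = Comp C X X Y (Comp C X (P Y) Y (\<pi> Y n) g) (endo_pow C X e (Suc m))"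
    using X Y e g(1) i by (simp only: endo_pow_Suc Comp_assoc Comp_closed power_closed endo_pow_closed)
  finally show ?case .
qed

text \<open>
  Dually, iterating \<open>h \<iota>\<^bsub>i+1\<^esub> = h S \<iota>\<^sub>i = d (h \<iota>\<^sub>i)\<close> upwards from \<open>i = 1\<close> shows that the first component
  of a morphism out of \<open>T X\<close> determines all the others.
\<close>

lemma eps_morphism_inj:
  assumes X: "X \<in> Ob C" and Y: "Y \<in> Ob C" and d: "d \<in> Hom C Y Y"
    and h: "h \<in> Hom C (P X) Y" "Comp C (P X) (P X) Y h (shift X) = Comp C (P X) Y Y d h"
    and m: "m < n"
  shows "Comp C X (P X) Y h (\<iota> X (m + 1))
    = Comp C X Y Y (endo_pow C Y d m) (Comp C X (P X) Y h (\<iota> X 1))"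
  using m
proof (induction m)
  case 0
  then have "1 \<in> {1..n}" by simp
  with X Y h(1) show ?case
    by (simp add: one_End_monoid Comp_Id_left Comp_closed power_closed del: One_nat_def)
next
  case (Suc m)
  then have i: "m + 1 \<in> {1..n}" "1 \<in> {1..n}" "m + 1 \<noteq> n" by auto
  have "Comp C X (P X) Y h (\<iota> X (Suc m + 1))
      = Comp C X (P X) Y h (Comp C X (P X) (P X) (shift X) (\<iota> X (m + 1)))"
    using X i by (simp only: shift_inj if_False) simp
  also have "\<dots> = Comp C X (P X) Y (Comp C (P X) Y Y d h) (\<iota> X (m + 1))"
    using X Y h(1) i by (simp only: h(2)[symmetric] Comp_assoc power_closed shift_closed)
  also have "\<dots> = Comp C X Y Y d (Comp C X (P X) Y h (\<iota> X (m + 1)))"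
    using X Y d h(1) i by (simp only: Comp_assoc power_closed)
  also have "\<dots> = Comp C X Y Y d
      (Comp C X Y Y (endo_pow C Y d m) (Comp C X (P X) Y h (\<iota> X 1)))"
    using Suc by simp
  also have "\<dots> = Comp C X Y Y (endo_pow C Y d (Suc m)) (Comp C X (P X) Y h (\<iota> X 1))"
    using X Y d h(1) i
    by (simp only: endo_pow_Suc2 Comp_assoc Comp_closed power_closed endo_pow_closed)
  finally show ?case .
qed

text \<open>
  The two universal properties. Uniqueness of the factorization is the preceding recursion. For
  existence the components are prescribed by that recursion, and nilpotency is what makes the
  resulting morphism commute with the endomorphisms at the boundary index (\<open>i = 1\<close> for the counit,
  \<open>i = n\<close> for the unit), where the shift gives zero.
\<close>

lemma last_proj_universal:
  assumes n: "n \<ge> 1" and Xe: "(X, e) \<in> Ob (eps_cat C n)" and Y: "Y \<in> Ob C" and k: "k \<in> Hom C X Y"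
  shows "\<exists>!g. g \<in> Hom (eps_cat C n) (X, e) (P Y, shift Y) \<and> Comp C X (P Y) Y (\<pi> Y n) g = k"
proof (rule ex_ex1I)
  have X: "X \<in> Ob C" and e: "e \<in> Hom C X X" and nil: "endo_pow C X e n = Zero C X X"
    using Xe by (simp_all add: eps_cat_simps)
  obtain g where g: "g \<in> Hom C X (P Y)"
    and proj_g: "\<And>i. i \<in> {1..n} \<Longrightarrow>
      Comp C X (P Y) Y (\<pi> Y i) g = Comp C X X Y k (endo_pow C X e (n - i))"
    by (rule obtain_into_power[OF Y X, of "\<lambda>i. Comp C X X Y k (endo_pow C X e (n - i))"])
      (use X Y e k in \<open>auto intro!: Comp_closed endo_pow_closed\<close>)
  have "Comp C X X (P Y) g e = Comp C X (P Y) (P Y) (shift Y) g"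
  proof (rule eq_if_proj_eq[OF Y X])
    fix i assume i: "i \<in> {1..n}"
    have "Comp C X (P Y) Y (\<pi> Y i) (Comp C X X (P Y) g e)
        = Comp C X X Y (Comp C X X Y k (endo_pow C X e (n - i))) e"
      using X Y e g i by (simp only: Comp_assoc power_closed proj_g)
    also have "\<dots> = Comp C X X Y k (endo_pow C X e (Suc (n - i)))"
      using X Y e k by (simp only: endo_pow_Suc Comp_assoc endo_pow_closed)
    also have "\<dots> = Comp C X (P Y) Y (if i = 1 then Zero C (P Y) Y else \<pi> Y (i - 1)) g"
    proof (cases "i = 1")
      case True
      \<comment> \<open>The component \<open>k e\<^sup>n\<close> vanishes, in agreement with \<open>\<pi>\<^sub>1 S = 0\<close>.\<close>
      then have "Suc (n - i) = n" using i by simp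
      with True X Y g k show ?thesis by (simp add: nil Comp_Zero_left Comp_Zero_right P_Ob)
    next
      case False
      then have "i - 1 \<in> {1..n}" "n - (i - 1) = Suc (n - i)" using i by auto
      with False show ?thesis by (simp only: proj_g if_False)
    qed
    also have "\<dots> = Comp C X (P Y) Y (\<pi> Y i) (Comp C X (P Y) (P Y) (shift Y) g)"
      using X Y g i by (simp only: Comp_assoc power_closed shift_closed proj_shift)
    finally show "Comp C X (P Y) Y (\<pi> Y i) (Comp C X X (P Y) g e)
      = Comp C X (P Y) Y (\<pi> Y i) (Comp C X (P Y) (P Y) (shift Y) g)" .
  qed (use X Y e g in \<open>auto intro!: Comp_closed P_Ob shift_closed\<close>)
  moreover have "Comp C X (P Y) Y (\<pi> Y n) g = k"
    using n X Y k proj_g[of n] by (simp add: one_End_monoid Comp_Id_right)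
  ultimately show "\<exists>g. g \<in> Hom (eps_cat C n) (X, e) (P Y, shift Y) \<and> Comp C X (P Y) Y (\<pi> Y n) g = k"
    using g by (auto simp: eps_cat_simps)
next
  have X: "X \<in> Ob C" and e: "e \<in> Hom C X X" using Xe by (simp_all add: eps_cat_simps)
  fix g g'
  assume g: "g \<in> Hom (eps_cat C n) (X, e) (P Y, shift Y) \<and> Comp C X (P Y) Y (\<pi> Y n) g = k"
    and g': "g' \<in> Hom (eps_cat C n) (X, e) (P Y, shift Y) \<and> Comp C X (P Y) Y (\<pi> Y n) g' = k"
  show "g = g'"
  proof (rule eq_if_proj_eq[OF Y X])
    fix i assume "i \<in> {1..n}"
    then have m: "n - i < n" and i: "n - (n - i) = i" by auto
    show "Comp C X (P Y) Y (\<pi> Y i) g = Comp C X (P Y) Y (\<pi> Y i) g'"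
      using proj_of_eps_morphism[OF X e Y _ _ m, of g] proj_of_eps_morphism[OF X e Y _ _ m, of g']
        g g' by (simp add: i eps_cat_simps)
  qed (use g g' in \<open>auto simp: eps_cat_simps\<close>)
qed

lemma first_inj_universal:
  assumes n: "n \<ge> 1" and X: "X \<in> Ob C" and Yd: "(Y, d) \<in> Ob (eps_cat C n)" and k: "k \<in> Hom C X Y"
  shows "\<exists>!h. h \<in> Hom (eps_cat C n) (P X, shift X) (Y, d) \<and> Comp C X (P X) Y h (\<iota> X 1) = k"
proof (rule ex_ex1I)
  have Y: "Y \<in> Ob C" and d: "d \<in> Hom C Y Y" and nil: "endo_pow C Y d n = Zero C Y Y"
    using Yd by (simp_all add: eps_cat_simps)
  obtain h where h: "h \<in> Hom C (P X) Y"
    and h_inj: "\<And>i. i \<in> {1..n} \<Longrightarrow>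
      Comp C X (P X) Y h (\<iota> X i) = Comp C X Y Y (endo_pow C Y d (i - 1)) k"
    by (rule obtain_from_power[OF X Y, of "\<lambda>i. Comp C X Y Y (endo_pow C Y d (i - 1)) k"])
      (use X Y d k in \<open>auto intro!: Comp_closed endo_pow_closed\<close>)
  have "Comp C (P X) (P X) Y h (shift X) = Comp C (P X) Y Y d h"
  proof (rule eq_if_inj_eq[OF X Y])
    fix i assume i: "i \<in> {1..n}"
    have "Comp C X (P X) Y (Comp C (P X) (P X) Y h (shift X)) (\<iota> X i)
        = Comp C X (P X) Y h (if i = n then Zero C X (P X) else \<iota> X (i + 1))"
      using X Y h i by (simp only: Comp_assoc[symmetric] power_closed shift_closed shift_inj)
    also have "\<dots> = Comp C X Y Y (endo_pow C Y d (Suc (i - 1))) k"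
    proof (cases "i = n")
      case True
      \<comment> \<open>The component \<open>d\<^sup>n k\<close> vanishes, in agreement with \<open>S \<iota>\<^sub>n = 0\<close>.\<close>
      then have "Suc (i - 1) = n" using n by simp
      with True X Y h k show ?thesis by (simp add: nil Comp_Zero_left Comp_Zero_right P_Ob)
    next
      case False
      then have "i + 1 \<in> {1..n}" "i + 1 - 1 = Suc (i - 1)" using i by auto
      with False show ?thesis by (simp only: h_inj if_False)
    qed
    also have "\<dots> = Comp C X Y Y d (Comp C X Y Y (endo_pow C Y d (i - 1)) k)"
      using X Y d k by (simp only: endo_pow_Suc2 Comp_assoc endo_pow_closed)
    also have "\<dots> = Comp C X (P X) Y (Comp C (P X) Y Y d h) (\<iota> X i)"
      using X Y d h i by (simp only: Comp_assoc[symmetric] power_closed h_inj)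
    finally show "Comp C X (P X) Y (Comp C (P X) (P X) Y h (shift X)) (\<iota> X i)
      = Comp C X (P X) Y (Comp C (P X) Y Y d h) (\<iota> X i)" .
  qed (use X Y d h in \<open>auto intro!: Comp_closed P_Ob shift_closed\<close>)
  moreover have "Comp C X (P X) Y h (\<iota> X 1) = k"
    using n X Y k h_inj[of 1] by (simp add: one_End_monoid Comp_Id_left)
  ultimately show "\<exists>h. h \<in> Hom (eps_cat C n) (P X, shift X) (Y, d) \<and> Comp C X (P X) Y h (\<iota> X 1) = k"
    using h by (auto simp: eps_cat_simps)
next
  have Y: "Y \<in> Ob C" and d: "d \<in> Hom C Y Y" using Yd by (simp_all add: eps_cat_simps)
  fix h h'
  assume h: "h \<in> Hom (eps_cat C n) (P X, shift X) (Y, d) \<and> Comp C X (P X) Y h (\<iota> X 1) = k"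
    and h': "h' \<in> Hom (eps_cat C n) (P X, shift X) (Y, d) \<and> Comp C X (P X) Y h' (\<iota> X 1) = k"
  show "h = h'"
  proof (rule eq_if_inj_eq[OF X Y])
    fix i assume "i \<in> {1..n}"
    then have m: "i - 1 < n" and i: "i - 1 + 1 = i" by auto
    show "Comp C X (P X) Y h (\<iota> X i) = Comp C X (P X) Y h' (\<iota> X i)"
      using eps_morphism_inj[OF X Y d _ _ m, of h] eps_morphism_inj[OF X Y d _ _ m, of h'] h h'
      unfolding i by (simp add: eps_cat_simps)
  qed (use h h' in \<open>auto simp: eps_cat_simps\<close>)
qed

lemma forgetful_augmenting_adjoint:
  assumes n: "n \<ge> 1"
  shows "adjoint_pair (eps_cat C n) C forgetful T"
proof (rule adjoint_pair_of_universal_counit[where \<theta> = "\<lambda>Y. \<pi> Y n"])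
  have last: "n \<in> {1..n}" using n by simp
  show "\<pi> Y n \<in> Hom C (Obj forgetful (Obj T Y)) Y" if "Y \<in> Ob C" for Y
    using that last by (simp add: forgetful_def augmenting_simps proj_closed)
  show "Comp C (Obj forgetful (Obj T Y)) Y Y' b (\<pi> Y n)
      = Comp C (Obj forgetful (Obj T Y)) (Obj forgetful (Obj T Y')) Y' (\<pi> Y' n)
          (Map forgetful (Obj T Y) (Obj T Y') (Map T Y Y' b))"
    if "Y \<in> Ob C" "Y' \<in> Ob C" "b \<in> Hom C Y Y'" for Y Y' b
    using that last by (simp add: forgetful_def augmenting_simps proj_diag)
  show "\<exists>!g. g \<in> Hom (eps_cat C n) X (Obj T Y) \<and>
      Comp C (Obj forgetful X) (Obj forgetful (Obj T Y)) Y (\<pi> Y n) (Map forgetful X (Obj T Y) g) = k"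
    if "X \<in> Ob (eps_cat C n)" "Y \<in> Ob C" "k \<in> Hom C (Obj forgetful X) Y" for X Y k
    using that last_proj_universal[OF n, of "fst X" "snd X" Y k]
    by (simp add: forgetful_def augmenting_simps)
qed (rule cat_functor_forgetful cat_functor_augmenting)+

lemma augmenting_forgetful_adjoint:
  assumes n: "n \<ge> 1"
  shows "adjoint_pair C (eps_cat C n) T forgetful"
proof (rule adjoint_pair_of_universal_unit[where \<eta> = "\<lambda>X. \<iota> X 1"])
  have first: "1 \<in> {1..n}" using n by simp
  show "\<iota> X 1 \<in> Hom C X (Obj forgetful (Obj T X))" if "X \<in> Ob C" for X
    using that first by (simp add: forgetful_def augmenting_simps inj_closed)
  show "Comp C X' X (Obj forgetful (Obj T X)) (\<iota> X 1) a
      = Comp C X' (Obj forgetful (Obj T X')) (Obj forgetful (Obj T X))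
          (Map forgetful (Obj T X') (Obj T X) (Map T X' X a)) (\<iota> X' 1)"
    if "X \<in> Ob C" "X' \<in> Ob C" "a \<in> Hom C X' X" for X X' a
    using that first by (simp add: forgetful_def augmenting_simps diag_inj)
  show "\<exists>!h. h \<in> Hom (eps_cat C n) (Obj T X) Y \<and>
      Comp C X (Obj forgetful (Obj T X)) (Obj forgetful Y) (Map forgetful (Obj T X) Y h) (\<iota> X 1) = k"
    if "X \<in> Ob C" "Y \<in> Ob (eps_cat C n)" "k \<in> Hom C X (Obj forgetful Y)" for X Y k
    using that first_inj_universal[OF n, of X "fst Y" "snd Y" k]
    by (simp add: forgetful_def augmenting_simps)
qed (rule cat_functor_forgetful cat_functor_augmenting)+

end

theorem proposition3p1:
  fixes C :: "('o, 'm) acat"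
    and n :: nat
    and P :: "'o \<Rightarrow> 'o"
    and \<iota> \<pi> :: "'o \<Rightarrow> nat \<Rightarrow> 'm"
  assumes "additive_category C"
    and "n \<ge> 2"
    and "biproduct_powers C n P \<iota> \<pi>"
  shows "adjoint_pair (eps_cat C n) C forgetful (augmenting C n P \<iota> \<pi>) \<and>
         adjoint_pair C (eps_cat C n) (augmenting C n P \<iota> \<pi>) forgetful"
proof -
  interpret biproduct_power_choice C n P \<iota> \<pi>
    using assms by (intro biproduct_power_choice.intro biproduct_power_choice_axioms.intro)
  show ?thesis
    using assms(2) forgetful_augmenting_adjoint augmenting_forgetful_adjoint by simp
qed

end
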